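(* Let $a$ and $b$ be integers with $2\leq a\leq b\leq 2a$. If $b=2a$ or $a+b\equiv 1\pmod 3$, then there is a unique tiling of the $(a,b)$-benzel by right stones, rising bones, and falling bones. If $b<2a$ and $a+b\equiv 0\pmod 3$, then there are no such tilings.
   Context: Let $\omega=e^{2\pi i/3}$. The hexagonal grid is the tiling of the complex plane by regular hexagons of side length $1$ (called cells) for which one of the cells is the hexagon with vertices $1\pm 1,\ 1\pm\omega,\ 1\pm\omega^2$ (so the cell centers are the points $1+m(1-\omega)+n(1-\omega^2)$ with $m,n\in\mathbb Z$). For integers $a,b$ with $2\le a\le 2b$ and $2\le b\le 2a$, the $(a,b)$-benzel is the union of the cells lying entirely within the (closed, possibly degenerate) hexagon with vertices $a\omega+b,\ -a\omega^2-b,\ a\omega^2+b\omega,\ -a-b\omega,\ a+b\omega^2,\ -a\omega-b\omega^2$. The prototiles, each a union of three cells, are described by the centers of their cells. A right stone has centers $v+1,v+\omega,v+\omega^2$. A rising bone has centers $c-\sqrt3e^{i\pi/6},\ c,\ c+\sqrt3e^{i\pi/6}$. A falling bone has centers $c-\sqrt3e^{-i\pi/6},\ c,\ c+\sqrt3e^{-i\pi/6}$. Tiles may be translated (so that they consist of cells of the grid) but not rotated. A tiling of a region (a union of cells) by given types of tiles is a set of tiles of those types such that each cell of the region is in exactly one tile and every tile is contained in the region. Not all types of tiles need be used. *)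

theory Defs
  imports "HOL-Analysis.Analysis" "HOL-Number_Theory.Cong"
begin

text \<open>Cells, tiles and regions are all point sets in the complex plane; a tile or a region is a
  union of cells of the grid.\<close>

definition omega :: complex ("\<omega>") where
  "\<omega> = cis (2 * pi / 3)"

definition cell :: "complex \<Rightarrow> complex set" where
  "cell c = convex hull {c + 1, c - 1, c + \<omega>, c - \<omega>, c + \<omega>\<^sup>2, c - \<omega>\<^sup>2}"

definition cell_centers :: "complex set" where
  "cell_centers = {1 + of_int m * (1 - \<omega>) + of_int n * (1 - \<omega>\<^sup>2) | m n :: int. True}"

definition cells :: "complex set set" where
  "cells = cell ` cell_centers"

text \<open>For \<open>a \<le> 2 * b\<close> and \<open>b \<le> 2 * a\<close> the six points below are, in this order, the vertices of a
  (possibly degenerate) convex hexagon, so that their convex hull is the closed hexagon.\<close>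

definition benzel_hexagon :: "int \<Rightarrow> int \<Rightarrow> complex set" where
  "benzel_hexagon a b = convex hull
     {of_int a * \<omega> + of_int b, - of_int a * \<omega>\<^sup>2 - of_int b,
      of_int a * \<omega>\<^sup>2 + of_int b * \<omega>, - of_int a - of_int b * \<omega>,
      of_int a + of_int b * \<omega>\<^sup>2, - of_int a * \<omega> - of_int b * \<omega>\<^sup>2}"

definition benzel :: "int \<Rightarrow> int \<Rightarrow> complex set" where
  "benzel a b = \<Union> {C \<in> cells. C \<subseteq> benzel_hexagon a b}"

text \<open>The prototiles are given by the centers of their cells, up to translation.\<close>

definition right_stone :: "complex set" where
  "right_stone = {1, \<omega>, \<omega>\<^sup>2}"

definition rising_bone :: "complex set" where
  "rising_bone = {- of_real (sqrt 3) * cis (pi / 6), 0, of_real (sqrt 3) * cis (pi / 6)}"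

definition falling_bone :: "complex set" where
  "falling_bone = {- of_real (sqrt 3) * cis (- pi / 6), 0, of_real (sqrt 3) * cis (- pi / 6)}"

text \<open>The tiles of a given type: the translates that consist of cells of the grid.\<close>

definition tiles_of_type :: "complex set \<Rightarrow> complex set set" where
  "tiles_of_type K = {\<Union>c\<in>K. cell (v + c) | v. \<forall>c\<in>K. v + c \<in> cell_centers}"

definition is_tiling :: "complex set set \<Rightarrow> complex set \<Rightarrow> complex set set \<Rightarrow> bool" where
  "is_tiling prototiles R T \<longleftrightarrow>
     (\<forall>t\<in>T. (\<exists>K\<in>prototiles. t \<in> tiles_of_type K) \<and> t \<subseteq> R) \<and>
     (\<forall>C\<in>cells. C \<subseteq> R \<longrightarrow> (\<exists>!t. t \<in> T \<and> C \<subseteq> t))"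

end

theory Submission
  imports Defs
begin

text \<open>Write the center of a cell as \<open>1 + m * (1 - \<omega>) + n * (1 - \<omega>\<^sup>2)\<close> with integers \<open>m\<close> and \<open>n\<close>, and
  call \<open>m - n\<close> the content and \<open>m + n\<close> the height of the cell. Every tile has one cell in each of
  three consecutive contents, and between consecutive contents the height changes by one: it goes
  up twice in a falling bone, down twice in a rising bone, and up and then down in a right stone.
  Down and then up would be the left stone, which does not occur.

  Both parts of the theorem are proved by linear programming duality. An integer weight on the
  cells is chosen that is nonnegative in total on every tile inside the benzel, while its sum over the
  whole benzel is zero. A tiling then consists only of tiles of weight zero.

  If \<open>a + b\<close> is congruent to \<open>1\<close> modulo three, the contents of the benzel fall into consecutive
  triples \<open>d, d + 1, d + 2\<close> such that the benzel is the disjoint union of the stones that start in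
  the first content of a triple (\<open>aligned_stones_tiling\<close>). The weight \<open>aligned_weight\<close> is zero on
  these stones and positive on every other tile, so the tiling by these stones is the only one.
  The case \<open>b = 2 * a\<close> reduces to this one, because the triangle contains the same cells as the
  region obtained when \<open>b\<close> is increased by one.

  If \<open>a + b\<close> is divisible by three and \<open>b < 2 * a\<close>, the benzel looks symmetric near the diagonal of
  content \<open>a - b\<close>, and \<open>mirror_weight\<close> is a weight invariant under that symmetry. The cells of
  nonzero weight cancel in pairs (\<open>mirror_partner_props\<close>), so the total is zero. The top cell of
  the diagonal is a corner of the benzel, and every tile that contains it and stays inside the
  benzel has positive weight (\<open>mirror_weight_corner_pos\<close>), so the corner cannot be covered.

  The translation from the plane to the lattice rests on two facts: the convex hulls of the
  definitions are given by bounds on distances in three directions (\<open>convex_hull_eq_hexagon\<close>),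
  and no cell contains the center of another cell (\<open>center_in_cell_iff\<close>).\<close>

section \<open>Hexagons in distance coordinates\<close>

text \<open>The point whose signed distances from the three lines through the origin parallel to
  \<open>1\<close>, \<open>\<omega>\<close> and \<open>\<omega>\<^sup>2\<close>, in units of half the square root of three, are \<open>x\<close>, \<open>y\<close> and \<open>- x - y\<close>. The sides of
  the cells and of the large hexagon are parallel to these three directions, so in these
  coordinates both are cut out by bounds on the three distances.\<close>

definition hex_point :: "real \<Rightarrow> real \<Rightarrow> complex" where
  "hex_point x y = of_real x * \<omega> - of_real y"

lemma Re_omega: "Re \<omega> = - 1 / 2" and Im_omega: "Im \<omega> = sqrt 3 / 2"
  by (simp_all add: omega_def cos_120 sin_120)

lemma omega_squared: "\<omega>\<^sup>2 = - 1 - \<omega>"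
  by (simp add: complex_eq_iff power2_eq_square Re_omega Im_omega)

lemma hex_point_eq_iff: "hex_point x y = hex_point x' y' \<longleftrightarrow> x = x' \<and> y = y'"
  by (auto simp: hex_point_def complex_eq_iff Re_omega Im_omega)

lemma hex_point_add: "hex_point x y + hex_point x' y' = hex_point (x + x') (y + y')"
  by (simp add: hex_point_def algebra_simps)

lemma hex_point_scaleR: "r *\<^sub>R hex_point x y = hex_point (r * x) (r * y)"
  by (simp add: hex_point_def scaleR_conv_of_real algebra_simps)

lemma convex_combination_in_convex:
  assumes "convex S" "hex_point x y \<in> S" "hex_point x' y' \<in> S" "0 \<le> t" "t \<le> 1"
  shows "hex_point ((1 - t) * x + t * x') ((1 - t) * y + t * y') \<in> S"
  using convexD_alt[OF assms] by (simp add: hex_point_scaleR hex_point_add)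

text \<open>Collinearity is stated without division, so that segments that shrink to a point, as the
  sides of a degenerate hexagon do, need no separate treatment.\<close>

lemma between_in_convex:
  assumes S: "convex S" "hex_point x y \<in> S" "hex_point x' y' \<in> S"
    and "min x x' \<le> u" "u \<le> max x x'" "min y y' \<le> v" "v \<le> max y y'"
    and "(u - x) * (y' - y) = (v - y) * (x' - x)"
  shows "hex_point u v \<in> S"
proof -
  have "\<exists>t\<ge>0. t \<le> 1 \<and> u = (1 - t) * x + t * x' \<and> v = (1 - t) * y + t * y'"
  proof (cases "x' = x")
    case True
    have "v \<in> closed_segment y y'"
      using assms(6,7) by (auto simp: closed_segment_eq_real_ivl)
    then obtain t where "0 \<le> t" "t \<le> 1" "v = (1 - t) * y + t * y'"
      by (auto simp: closed_segment_def)
    then show ?thesis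
      using True assms(4,5) by (intro exI[of _ t]) (simp add: algebra_simps)
  next
    case False
    have "u \<in> closed_segment x x'"
      using assms(4,5) by (auto simp: closed_segment_eq_real_ivl)
    then obtain t where t: "0 \<le> t" "t \<le> 1" "u = (1 - t) * x + t * x'"
      by (auto simp: closed_segment_def)
    then have ux: "u - x = t * (x' - x)" by (simp add: algebra_simps)
    have "(v - y) * (x' - x) = (t * (y' - y)) * (x' - x)"
      unfolding assms(8)[symmetric] ux by (simp only: mult_ac)
    then have "v - y = t * (y' - y)" using False by (simp only: mult_cancel_right) simp
    then show ?thesis
      using t by (intro exI[of _ t]) (simp add: algebra_simps)
  qed
  then show ?thesis
    using convex_combination_in_convex[OF S] by blast
qed

definition hexagon :: "real \<Rightarrow> real \<Rightarrow> complex set" where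
  "hexagon a b = {hex_point x y | x y.
     - b \<le> x \<and> x \<le> a \<and> - b \<le> y \<and> y \<le> a \<and> - b \<le> - x - y \<and> - x - y \<le> a}"

lemma hex_point_in_hexagon:
  "hex_point x y \<in> hexagon a b \<longleftrightarrow>
     - b \<le> x \<and> x \<le> a \<and> - b \<le> y \<and> y \<le> a \<and> - b \<le> - x - y \<and> - x - y \<le> a"
  by (auto simp: hexagon_def hex_point_eq_iff)

lemma convex_hexagon: "convex (hexagon a b)"
proof (rule convexI)
  fix z z' :: complex and u v :: real
  assume "z \<in> hexagon a b" "z' \<in> hexagon a b" and uv: "0 \<le> u" "0 \<le> v" "u + v = 1"
  then obtain x y x' y' where z: "z = hex_point x y" "z' = hex_point x' y'"
    and *: "- b \<le> x" "x \<le> a" "- b \<le> y" "y \<le> a" "- b \<le> - x - y" "- x - y \<le> a"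
      "- b \<le> x'" "x' \<le> a" "- b \<le> y'" "y' \<le> a" "- b \<le> - x' - y'" "- x' - y' \<le> a"
    by (auto simp: hexagon_def)
  have bnd: "- b \<le> u * s + v * t \<and> u * s + v * t \<le> a"
    if "- b \<le> s" "s \<le> a" "- b \<le> t" "t \<le> a" for s t
    using convex_bound_le[of s a t u v] convex_bound_le[of "- s" b "- t" u v] that uv by simp
  have "- u * x - v * x' - (u * y + v * y') = u * (- x - y) + v * (- x' - y')"
    by (simp add: algebra_simps)
  with bnd[of x x'] bnd[of y y'] bnd[of "- x - y" "- x' - y'"] *
  show "u *\<^sub>R z + v *\<^sub>R z' \<in> hexagon a b"
    by (simp add: z hex_point_scaleR hex_point_add hex_point_in_hexagon)
qed

text \<open>The side conditions say \<open>- b \<le> b - a\<close> and \<open>b - a \<le> a\<close>: they make the six points, whose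
  distance triples are the permutations of \<open>(a, b - a, - b)\<close>, satisfy the bounds of the hexagon.
  Conversely the line on which the first distance is constant meets the hexagon in a segment with
  both ends on sides of the hexagon; which sides depends on whether the line runs above or below
  the two middle vertices, at height \<open>b - a\<close>.\<close>

lemma convex_hull_eq_hexagon:
  fixes a b :: real
  assumes "a \<le> 2 * b" "b \<le> 2 * a"
  shows "convex hull {hex_point a (- b), hex_point a (b - a), hex_point (b - a) a,
    hex_point (- b) a, hex_point (- b) (b - a), hex_point (b - a) (- b)} = hexagon a b"
    (is "?H = _")
proof
  show "?H \<subseteq> hexagon a b"
    using assms by (intro hull_minimal convex_hexagon) (auto simp: hex_point_in_hexagon)
  have V: "hex_point a (- b) \<in> ?H" "hex_point a (b - a) \<in> ?H" "hex_point (b - a) a \<in> ?H"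
    "hex_point (- b) a \<in> ?H" "hex_point (- b) (b - a) \<in> ?H" "hex_point (b - a) (- b) \<in> ?H"
    by (simp_all add: hull_inc)
  note seg = between_in_convex[OF convex_convex_hull]
  show "hexagon a b \<subseteq> ?H"
  proof
    fix z assume "z \<in> hexagon a b"
    then obtain x y where z: "z = hex_point x y"
      and xy: "- b \<le> x" "x \<le> a" "- b \<le> y" "y \<le> a" "- b \<le> - x - y" "- x - y \<le> a"
      by (auto simp: hexagon_def)
    show "z \<in> ?H"
    proof (cases "b - a \<le> x")
      case True
      have "hex_point x (b - x) \<in> ?H"
        by (rule seg[OF V(2) V(3)]) (use True xy assms in \<open>auto simp: algebra_simps\<close>)
      moreover have "hex_point x (- b) \<in> ?H"
        by (rule seg[OF V(1) V(6)]) (use True xy assms in \<open>auto simp: algebra_simps\<close>)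
      ultimately show ?thesis
        unfolding z by (rule seg) (use True xy assms in \<open>auto simp: algebra_simps\<close>)
    next
      case False
      have "hex_point x a \<in> ?H"
        by (rule seg[OF V(3) V(4)]) (use False xy assms in \<open>auto simp: algebra_simps\<close>)
      moreover have "hex_point x (- a - x) \<in> ?H"
        by (rule seg[OF V(5) V(6)]) (use False xy assms in \<open>auto simp: algebra_simps\<close>)
      ultimately show ?thesis
        unfolding z by (rule seg) (use False xy assms in \<open>auto simp: algebra_simps\<close>)
    qed
  qed
qed

lemma benzel_hexagon_eq:
  assumes "a \<le> 2 * b" "b \<le> 2 * a"
  shows "benzel_hexagon a b = hexagon (of_int a) (of_int b)"
proof -
  have "real_of_int a \<le> 2 * of_int b" "real_of_int b \<le> 2 * of_int a"
    using assms by linarith+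
  note eq = convex_hull_eq_hexagon[OF this]
  show ?thesis
    unfolding benzel_hexagon_def omega_squared eq[symmetric]
    by (intro arg_cong[of _ _ "\<lambda>S. convex hull S"])
       (auto simp: hex_point_def algebra_simps)
qed

lemma cell_hex_point: "cell (hex_point x y) = (+) (hex_point x y) ` hexagon 1 1"
proof -
  have "{c + 1, c - 1, c + \<omega>, c - \<omega>, c + \<omega>\<^sup>2, c - \<omega>\<^sup>2} = (+) c `
    {hex_point 1 (- 1), hex_point 1 (1 - 1), hex_point (1 - 1) 1,
     hex_point (- 1) 1, hex_point (- 1) (1 - 1), hex_point (1 - 1) (- 1)}" for c
    unfolding omega_squared by (auto simp: hex_point_def algebra_simps)
  moreover have "hexagon 1 1 = convex hull {hex_point 1 (- 1), hex_point 1 (1 - 1),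
    hex_point (1 - 1) 1, hex_point (- 1) 1, hex_point (- 1) (1 - 1), hex_point (1 - 1) (- 1)}"
    by (rule convex_hull_eq_hexagon[symmetric]) simp_all
  ultimately show ?thesis
    unfolding cell_def by (simp only: convex_hull_translation)
qed

lemma hex_point_in_cell:
  "hex_point x y \<in> cell (hex_point x' y') \<longleftrightarrow>
     \<bar>x - x'\<bar> \<le> 1 \<and> \<bar>y - y'\<bar> \<le> 1 \<and> \<bar>(x - x') + (y - y')\<bar> \<le> 1"
proof -
  have "hex_point x y \<in> cell (hex_point x' y') \<longleftrightarrow> hex_point (x - x') (y - y') \<in> hexagon 1 1"
    unfolding cell_hex_point
  proof
    assume "hex_point x y \<in> (+) (hex_point x' y') ` hexagon 1 1"
    then show "hex_point (x - x') (y - y') \<in> hexagon 1 1"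
      by (auto simp: hexagon_def hex_point_add hex_point_eq_iff)
  next
    assume "hex_point (x - x') (y - y') \<in> hexagon 1 1"
    then show "hex_point x y \<in> (+) (hex_point x' y') ` hexagon 1 1"
      by (rule rev_image_eqI) (simp add: hex_point_add)
  qed
  then show ?thesis by (auto simp: hex_point_in_hexagon)
qed

text \<open>A cell reaches exactly distance \<open>1\<close> from its center in each of the six directions.\<close>

lemma cell_subset_hexagon_iff:
  "cell (hex_point x y) \<subseteq> hexagon a b \<longleftrightarrow> hex_point x y \<in> hexagon (a - 1) (b - 1)"
proof
  assume sub: "cell (hex_point x y) \<subseteq> hexagon a b"
  have "hex_point (x + i) (y + j) \<in> hexagon a b"
    if "(i, j) \<in> {(0, 1), (0, - 1), (1, 0), (- 1, 0)}" for i j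
    using that by (intro subsetD[OF sub]) (auto simp: hex_point_in_cell)
  from this[of 0 1] this[of 0 "- 1"] this[of 1 0] this[of "- 1" 0]
  show "hex_point x y \<in> hexagon (a - 1) (b - 1)"
    by (simp add: hex_point_in_hexagon)
next
  assume *: "hex_point x y \<in> hexagon (a - 1) (b - 1)"
  show "cell (hex_point x y) \<subseteq> hexagon a b"
  proof
    fix z assume "z \<in> cell (hex_point x y)"
    moreover from this obtain x' y' where "z = hex_point x' y'"
      unfolding cell_hex_point hexagon_def by (auto simp: hex_point_add)
    ultimately show "z \<in> hexagon a b"
      using * by (simp add: hex_point_in_cell hex_point_in_hexagon abs_le_iff)
  qed
qed

section \<open>Lattice coordinates of cells\<close>

fun center :: "int \<times> int \<Rightarrow> complex" where
  "center (m, n) = hex_point (of_int (n - m)) (of_int (- 1 - m - 2 * n))"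

lemma center_eq: "center (m, n) = 1 + of_int m * (1 - \<omega>) + of_int n * (1 - \<omega>\<^sup>2)"
  by (simp add: hex_point_def omega_squared algebra_simps)

lemma cell_centers_eq: "cell_centers = range center"
  unfolding cell_centers_def center_eq[symmetric] by (auto simp del: center.simps)

text \<open>No cell contains the center of another cell. This is what turns inclusions between unions of
  cells into inclusions between sets of lattice coordinates.\<close>

lemma center_in_cell_iff: "center p \<in> cell (center q) \<longleftrightarrow> p = q"
proof (cases p; cases q)
  fix m n m' n' assume pq: "p = (m, n)" "q = (m', n')"
  have "center p \<in> cell (center q) \<longleftrightarrow> \<bar>(n - m) - (n' - m')\<bar> \<le> 1 \<and>
      \<bar>(- 1 - m - 2 * n) - (- 1 - m' - 2 * n')\<bar> \<le> 1 \<and>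
      \<bar>(n - m) - (n' - m') + ((- 1 - m - 2 * n) - (- 1 - m' - 2 * n'))\<bar> \<le> 1"
    unfolding pq center.simps hex_point_in_cell by linarith
  also have "\<dots> \<longleftrightarrow> m = m' \<and> n = n'"
  proof (intro iffI conjI)
    assume *: "\<bar>(n - m) - (n' - m')\<bar> \<le> 1 \<and>
      \<bar>(- 1 - m - 2 * n) - (- 1 - m' - 2 * n')\<bar> \<le> 1 \<and>
      \<bar>(n - m) - (n' - m') + ((- 1 - m - 2 * n) - (- 1 - m' - 2 * n'))\<bar> \<le> 1"
    show "m = m'" using * by linarith
    show "n = n'" using * by linarith
  qed simp_all
  also have "\<dots> \<longleftrightarrow> p = q" by (simp add: pq)
  finally show ?thesis .
qed

definition region :: "(int \<times> int) set \<Rightarrow> complex set" where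
  "region A = (\<Union>p\<in>A. cell (center p))"

lemma cell_subset_region_iff: "cell (center p) \<subseteq> region A \<longleftrightarrow> p \<in> A"
proof
  assume "cell (center p) \<subseteq> region A"
  then have "center p \<in> region A" using center_in_cell_iff by blast
  then show "p \<in> A" by (auto simp: region_def center_in_cell_iff)
qed (auto simp: region_def)

lemma region_subset_iff: "region A \<subseteq> region B \<longleftrightarrow> A \<subseteq> B"
proof -
  have "region A \<subseteq> region B \<longleftrightarrow> (\<forall>p\<in>A. cell (center p) \<subseteq> region B)"
    by (auto simp: region_def)
  then show ?thesis by (auto simp: cell_subset_region_iff)
qed

lemma inj_region: "inj region"
  by (intro injI equalityI) (simp_all flip: region_subset_iff)

definition benzel_cells :: "int \<Rightarrow> int \<Rightarrow> (int \<times> int) set" where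
  "benzel_cells a b = {(m, n). 1 - a \<le> m - n \<and> m - n \<le> b - 1 \<and>
     - a \<le> m + 2 * n \<and> m + 2 * n \<le> b - 2 \<and> - b \<le> 2 * m + n \<and> 2 * m + n \<le> a - 2}"

lemma finite_benzel_cells: "finite (benzel_cells a b)"
  by (rule finite_subset[of _ "{- b..a} \<times> {- a..b}"]) (auto simp: benzel_cells_def)

lemma benzel_eq_region:
  assumes "a \<le> 2 * b" "b \<le> 2 * a"
  shows "benzel a b = region (benzel_cells a b)"
proof -
  have "cell (center p) \<subseteq> benzel_hexagon a b \<longleftrightarrow> p \<in> benzel_cells a b" for p
  proof (cases p)
    case (Pair m n)
    show ?thesis
      unfolding Pair benzel_hexagon_eq[OF assms] center.simps cell_subset_hexagon_iff
        hex_point_in_hexagon benzel_cells_def mem_Collect_eq prod.case by linarith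
  qed
  then show ?thesis
    by (auto simp: benzel_def region_def cells_def cell_centers_eq)
qed

section \<open>The tiles as trominoes in the lattice\<close>

text \<open>The argument is the cell with the smallest content \<open>m - n\<close>; the cells are listed by
  increasing content.\<close>

definition stone :: "int \<times> int \<Rightarrow> (int \<times> int) set" where
  "stone = (\<lambda>(m, n). {(m, n), (m + 1, n), (m + 1, n - 1)})"

definition rising :: "int \<times> int \<Rightarrow> (int \<times> int) set" where
  "rising = (\<lambda>(m, n). {(m, n), (m, n - 1), (m, n - 2)})"

definition falling :: "int \<times> int \<Rightarrow> (int \<times> int) set" where
  "falling = (\<lambda>(m, n). {(m, n), (m + 1, n), (m + 2, n)})"

definition trominoes :: "(int \<times> int) set set" where
  "trominoes = range stone \<union> range rising \<union> range falling"

abbreviation prototiles :: "complex set set" where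
  "prototiles \<equiv> {right_stone, rising_bone, falling_bone}"

lemma rising_step: "of_real (sqrt 3) * cis (pi / 6) = 1 - \<omega>\<^sup>2"
  unfolding omega_squared by (simp add: complex_eq_iff Re_omega Im_omega cos_30 sin_30)

lemma falling_step: "of_real (sqrt 3) * cis (- pi / 6) = 1 - \<omega>"
  by (simp add: complex_eq_iff Re_omega Im_omega cos_30 sin_30)

text \<open>The cell \<open>c\<close> of the prototile is the one that lands on \<open>p\<close>, so translations correspond
  to the lattice points \<open>p\<close>.\<close>

lemma tiles_of_type_eq:
  assumes "c \<in> K" and t: "\<And>p. center ` t p = (\<lambda>z. center p - c + z) ` K"
  shows "tiles_of_type K = range (\<lambda>p. region (t p))"
proof -
  have tile: "region (t p) = (\<Union>z\<in>K. cell (center p - c + z))" for p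
  proof -
    have "region (t p) = \<Union> (cell ` center ` t p)" by (simp add: region_def)
    then show ?thesis unfolding t by simp
  qed
  show ?thesis
  proof (intro equalityI subsetI)
    fix S assume "S \<in> tiles_of_type K"
    then obtain v where v: "S = (\<Union>z\<in>K. cell (v + z))" "v + c \<in> cell_centers"
      using \<open>c \<in> K\<close> by (auto simp: tiles_of_type_def)
    then obtain p where "v + c = center p" by (auto simp: cell_centers_eq)
    then have "v = center p - c" by (simp add: algebra_simps)
    with v tile show "S \<in> range (\<lambda>p. region (t p))" by auto
  next
    fix S assume "S \<in> range (\<lambda>p. region (t p))"
    then obtain p where p: "S = region (t p)" by blast
    have "center p - c + z \<in> cell_centers" if "z \<in> K" for z
      using t[of p] that by (auto simp: cell_centers_eq)
    then show "S \<in> tiles_of_type K"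
      unfolding tiles_of_type_def p tile by blast
  qed
qed

lemma tiles_of_prototiles: "(\<exists>K\<in>prototiles. t \<in> tiles_of_type K) \<longleftrightarrow> t \<in> region ` trominoes"
proof -
  have "tiles_of_type right_stone = range (\<lambda>p. region (stone p))"
  proof (rule tiles_of_type_eq)
    show "center ` stone p = (\<lambda>z. center p - \<omega> + z) ` right_stone" for p
      by (cases p) (simp add: stone_def right_stone_def center_eq algebra_simps insert_commute
          del: center.simps)
  qed (simp add: right_stone_def)
  moreover have "tiles_of_type rising_bone = range (\<lambda>p. region (rising p))"
  proof (rule tiles_of_type_eq)
    show "center ` rising p = (\<lambda>z. center p - (1 - \<omega>\<^sup>2) + z) ` rising_bone" for p
      unfolding rising_bone_def mult_minus_left rising_step
      by (cases p) (simp add: rising_def center_eq algebra_simps insert_commute del: center.simps)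
    show "1 - \<omega>\<^sup>2 \<in> rising_bone"
      unfolding rising_bone_def mult_minus_left rising_step by simp
  qed
  moreover have "tiles_of_type falling_bone = range (\<lambda>p. region (falling p))"
  proof (rule tiles_of_type_eq)
    show "center ` falling p = (\<lambda>z. center p - - (1 - \<omega>) + z) ` falling_bone" for p
      unfolding falling_bone_def mult_minus_left falling_step
      by (cases p) (simp add: falling_def center_eq algebra_simps insert_commute del: center.simps)
    show "- (1 - \<omega>) \<in> falling_bone"
      unfolding falling_bone_def mult_minus_left falling_step by simp
  qed
  ultimately show ?thesis
    by (auto simp: trominoes_def image_Un image_image)
qed

definition tromino_tiling :: "(int \<times> int) set \<Rightarrow> (int \<times> int) set set \<Rightarrow> bool" where
  "tromino_tiling R X \<longleftrightarrow>
     (\<forall>A\<in>X. A \<in> trominoes \<and> A \<subseteq> R) \<and> (\<forall>p\<in>R. \<exists>!A. A \<in> X \<and> p \<in> A)"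

lemma is_tiling_prototiles:
  "is_tiling prototiles S T \<longleftrightarrow> (\<forall>t\<in>T. t \<in> region ` trominoes \<and> t \<subseteq> S) \<and>
     (\<forall>C\<in>cells. C \<subseteq> S \<longrightarrow> (\<exists>!t. t \<in> T \<and> C \<subseteq> t))"
  unfolding is_tiling_def tiles_of_prototiles ..

lemma is_tiling_region_image:
  "is_tiling prototiles (region R) (region ` X) \<longleftrightarrow> tromino_tiling R X"
proof -
  have "(\<exists>!t. t \<in> region ` X \<and> P t) \<longleftrightarrow> (\<exists>!A. A \<in> X \<and> P (region A))" for P
  proof
    assume "\<exists>!t. t \<in> region ` X \<and> P t"
    then obtain t where "t \<in> region ` X" "P t"
      and eq: "\<forall>s. s \<in> region ` X \<and> P s \<longrightarrow> s = t"
      unfolding Ex1_def by (elim exE conjE)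
    then obtain A where A: "A \<in> X" "P (region A)" "t = region A" by blast
    show "\<exists>!A. A \<in> X \<and> P (region A)"
    proof (rule ex1I[of _ A])
      fix B assume "B \<in> X \<and> P (region B)"
      with eq have "region B = t" by simp
      then show "B = A" using A inj_region by (simp add: inj_eq)
    qed (use A in simp)
  next
    assume "\<exists>!A. A \<in> X \<and> P (region A)"
    then obtain A where A: "A \<in> X" "P (region A)"
      and eq: "\<forall>B. B \<in> X \<and> P (region B) \<longrightarrow> B = A"
      unfolding Ex1_def by (elim exE conjE)
    show "\<exists>!t. t \<in> region ` X \<and> P t"
    proof (rule ex1I[of _ "region A"])
      fix t assume t: "t \<in> region ` X \<and> P t"
      then obtain B where B: "t = region B" "B \<in> X" by blast
      with t have "B \<in> X \<and> P (region B)" by simp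
      then have "B = A" using eq by blast
      then show "t = region A" using B by simp
    qed (use A in simp)
  qed
  moreover have "region A \<in> region ` trominoes \<longleftrightarrow> A \<in> trominoes" for A
    using inj_region by (simp add: inj_image_mem_iff)
  ultimately show ?thesis
    by (simp only: is_tiling_prototiles tromino_tiling_def cells_def cell_centers_eq
        ball_simps ball_UNIV region_subset_iff cell_subset_region_iff) (simp only: Ball_def)
qed

text \<open>From here on the plane can be forgotten: \<open>region\<close> is injective, so tilings of \<open>region R\<close>
  and tromino tilings of \<open>R\<close> determine each other.\<close>

lemma is_tiling_region_iff:
  "is_tiling prototiles (region R) T \<longleftrightarrow> (\<exists>X. T = region ` X \<and> tromino_tiling R X)"
proof
  assume T: "is_tiling prototiles (region R) T"
  then have "T \<subseteq> region ` trominoes"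
    by (auto simp: is_tiling_prototiles)
  then obtain X where "T = region ` X" by (auto simp: subset_image_iff)
  with T show "\<exists>X. T = region ` X \<and> tromino_tiling R X"
    by (auto simp: is_tiling_region_image)
qed (auto simp: is_tiling_region_image)

section \<open>Weights and tilings\<close>

lemma tromino_cases:
  assumes "A \<in> trominoes"
  obtains (stone) m n where "A = stone (m, n)"
    | (rising) m n where "A = rising (m, n)"
    | (falling) m n where "A = falling (m, n)"
  using assms by (auto simp: trominoes_def)

lemma sum_stone: "sum f (stone (m, n)) = f (m, n) + f (m + 1, n) + f (m + 1, n - 1)"
  and sum_rising: "sum f (rising (m, n)) = f (m, n) + f (m, n - 1) + f (m, n - 2)"
  and sum_falling: "sum f (falling (m, n)) = f (m, n) + f (m + 1, n) + f (m + 2, n)"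
  for f :: "int \<times> int \<Rightarrow> int"
  by (simp_all add: stone_def rising_def falling_def)

lemma finite_tromino_tiling: "finite R \<Longrightarrow> tromino_tiling R X \<Longrightarrow> finite X"
  by (rule finite_subset[of X "Pow R"]) (auto simp: tromino_tiling_def)

lemma sum_over_tiling:
  fixes f :: "int \<times> int \<Rightarrow> int"
  assumes "finite R" and X: "tromino_tiling R X"
  shows "sum f R = (\<Sum>A\<in>X. sum f A)"
proof -
  have "\<Union> X = R" using X unfolding tromino_tiling_def by blast
  moreover have "\<forall>A\<in>X. finite A"
    using X \<open>finite R\<close> unfolding tromino_tiling_def by (meson finite_subset)
  moreover have "\<forall>A\<in>X. \<forall>B\<in>X. A \<noteq> B \<longrightarrow> A \<inter> B = {}"
    using X unfolding tromino_tiling_def by blast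
  ultimately show ?thesis
    using sum.Union_disjoint[of X f] by simp
qed

text \<open>Summing \<open>f\<close> over \<open>R\<close> along \<open>Y\<close> gives zero; summing it along any other tiling gives a sum of
  nonnegative terms, so each of them vanishes and each tile already belongs to \<open>Y\<close>.\<close>

lemma tiling_unique_if_weight_vanishes_on_it:
  fixes f :: "int \<times> int \<Rightarrow> int"
  assumes "finite R" and Y: "tromino_tiling R Y"
    and nonneg: "\<And>A. A \<in> trominoes \<Longrightarrow> A \<subseteq> R \<Longrightarrow> 0 \<le> sum f A"
    and zero: "\<And>A. A \<in> trominoes \<Longrightarrow> A \<subseteq> R \<Longrightarrow> sum f A = 0 \<longleftrightarrow> A \<in> Y"
    and X: "tromino_tiling R X"
  shows "X = Y"
proof -
  have tile: "A \<in> trominoes" "A \<subseteq> R" if "A \<in> X \<or> A \<in> Y" for A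
    using that X Y by (auto simp: tromino_tiling_def)
  have "finite X" using finite_tromino_tiling[OF \<open>finite R\<close> X] .
  have "sum f R = 0"
    unfolding sum_over_tiling[OF \<open>finite R\<close> Y] using zero tile by (intro sum.neutral) auto
  then have "\<forall>A\<in>X. sum f A = 0"
    using sum_over_tiling[OF \<open>finite R\<close> X, of f] \<open>finite X\<close> nonneg tile
    by (subst sum_nonneg_eq_0_iff[symmetric]) auto
  then have "X \<subseteq> Y" using zero tile by blast
  moreover have "Y \<subseteq> X"
  proof
    fix A assume A: "A \<in> Y"
    then obtain p where p: "p \<in> A" "p \<in> R"
      using tile[of A]
      by (auto simp: trominoes_def stone_def rising_def falling_def)
    then obtain B where "B \<in> X" "p \<in> B" using X by (auto simp: tromino_tiling_def)
    with \<open>X \<subseteq> Y\<close> Y A p have "B = A" unfolding tromino_tiling_def by blast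
    with \<open>B \<in> X\<close> show "A \<in> X" by simp
  qed
  ultimately show ?thesis by blast
qed

section \<open>The tiling by aligned stones\<close>

definition aligned_stones :: "int \<Rightarrow> (int \<times> int) set \<Rightarrow> (int \<times> int) set set" where
  "aligned_stones c R = {stone (m, n) | m n. (m, n) \<in> R \<and> [m - n = c] (mod 3)}"

lemma residue_cases:
  fixes d c :: int
  obtains k where "d = c + 3 * k" | k where "d = c + 3 * k + 1" | k where "d = c + 3 * k + 2"
proof -
  have "\<exists>k. d = c + 3 * k \<or> d = c + 3 * k + 1 \<or> d = c + 3 * k + 2" by presburger
  then show thesis using that by blast
qed

text \<open>With content \<open>d = m - n\<close> and height \<open>s = m + n\<close>, the three consecutive contents
  \<open>c + 3 * k\<close>, \<open>c + 3 * k + 1\<close> and \<open>c + 3 * k + 2\<close> carry the weights \<open>s + 2 * k\<close>, \<open>2 - 2 * s\<close> and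
  \<open>s - 2 * k\<close>. The heights along a tile starting at such a triple are \<open>s, s + 1, s\<close> for a stone
  and \<open>s, s + 1, s + 2\<close> or \<open>s, s - 1, s - 2\<close> for a bone, and the weights are the linear functions
  that cancel on the stone and give \<open>2\<close> on both bones. The multiples of \<open>k\<close> cancel within a triple
  but not across two triples; their slope is large enough to make all tiles that straddle two
  triples positive.\<close>

definition aligned_weight :: "int \<Rightarrow> int \<times> int \<Rightarrow> int" where
  "aligned_weight c = (\<lambda>(m, n). let k = (m - n - c) div 3 in
     if (m - n - c) mod 3 = 0 then m + n + 2 * k
     else if (m - n - c) mod 3 = 1 then 2 - 2 * (m + n)
     else m + n - 2 * k)"

lemma aligned_weight_0: "m - n = c + 3 * k \<Longrightarrow> aligned_weight c (m, n) = m + n + 2 * k"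
  and aligned_weight_1: "m - n = c + 3 * k + 1 \<Longrightarrow> aligned_weight c (m, n) = 2 - 2 * (m + n)"
  and aligned_weight_2: "m - n = c + 3 * k + 2 \<Longrightarrow> aligned_weight c (m, n) = m + n - 2 * k"
proof -
  have *: "m - n - c = 3 * k + r" if "m - n = c + 3 * k + r" for r using that by simp
  show "m - n = c + 3 * k \<Longrightarrow> aligned_weight c (m, n) = m + n + 2 * k"
    using *[of 0] by (simp add: aligned_weight_def Let_def)
  show "m - n = c + 3 * k + 1 \<Longrightarrow> aligned_weight c (m, n) = 2 - 2 * (m + n)"
    using *[of 1] by (simp add: aligned_weight_def Let_def)
  show "m - n = c + 3 * k + 2 \<Longrightarrow> aligned_weight c (m, n) = m + n - 2 * k"
    using *[of 2] by (simp add: aligned_weight_def Let_def)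
qed

lemma aligned_weight_stone:
  "sum (aligned_weight c) (stone (m, n)) \<ge> 0"
  "sum (aligned_weight c) (stone (m, n)) = 0 \<longleftrightarrow> [m - n = c] (mod 3)"
proof -
  have "sum (aligned_weight c) (stone (m, n)) = (if [m - n = c] (mod 3) then 0 else 5)"
  proof (cases rule: residue_cases[of "m - n" c])
    case (1 k)
    then show ?thesis
      by (simp add: sum_stone aligned_weight_0[of _ _ _ k] aligned_weight_1[of _ _ _ k]
          aligned_weight_2[of _ _ _ k] cong_def)
  next
    case (2 k)
    then have "\<not> [m - n = c] (mod 3)" unfolding cong_iff_dvd_diff by presburger
    with 2 show ?thesis
      by (simp add: sum_stone aligned_weight_1[of _ _ _ k] aligned_weight_2[of _ _ _ k]
          aligned_weight_0[of _ _ _ "k + 1"])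
  next
    case (3 k)
    then have "\<not> [m - n = c] (mod 3)" unfolding cong_iff_dvd_diff by presburger
    with 3 show ?thesis
      by (simp add: sum_stone aligned_weight_2[of _ _ _ k]
          aligned_weight_0[of _ _ _ "k + 1"] aligned_weight_1[of _ _ _ "k + 1"])
  qed
  then show "sum (aligned_weight c) (stone (m, n)) \<ge> 0"
    "sum (aligned_weight c) (stone (m, n)) = 0 \<longleftrightarrow> [m - n = c] (mod 3)" by auto
qed

lemma aligned_weight_bone:
  "sum (aligned_weight c) (rising (m, n)) > 0"
  "sum (aligned_weight c) (falling (m, n)) > 0"
proof -
  have "sum (aligned_weight c) (rising (m, n)) > 0 \<and> sum (aligned_weight c) (falling (m, n)) > 0"
  proof (cases rule: residue_cases[of "m - n" c])
    case (1 k)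
    then show ?thesis
      by (simp add: sum_rising sum_falling aligned_weight_0[of _ _ _ k]
          aligned_weight_1[of _ _ _ k] aligned_weight_2[of _ _ _ k])
  next
    case (2 k)
    then show ?thesis
      by (simp add: sum_rising sum_falling aligned_weight_1[of _ _ _ k]
          aligned_weight_2[of _ _ _ k] aligned_weight_0[of _ _ _ "k + 1"])
  next
    case (3 k)
    then show ?thesis
      by (simp add: sum_rising sum_falling aligned_weight_2[of _ _ _ k]
          aligned_weight_0[of _ _ _ "k + 1"] aligned_weight_1[of _ _ _ "k + 1"])
  qed
  then show "sum (aligned_weight c) (rising (m, n)) > 0"
    "sum (aligned_weight c) (falling (m, n)) > 0" by auto
qed

text \<open>On the contents congruent to \<open>1 - a\<close> the quantities bounded in the definition of the region have
  known residues modulo three. Rounded accordingly, the bounds for all three cells of a stone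
  become the same inequalities.\<close>

lemma aligned_stone_in_benzel:
  assumes "[a + b = 1] (mod 3)" "[m - n = 1 - a] (mod 3)"
  shows "(m + 1, n) \<in> benzel_cells a b \<longleftrightarrow> (m, n) \<in> benzel_cells a b"
    and "(m + 1, n - 1) \<in> benzel_cells a b \<longleftrightarrow> (m, n) \<in> benzel_cells a b"
proof -
  have "3 dvd a + b - 1" "3 dvd m - n - (1 - a)"
    using assms by (simp_all add: cong_iff_dvd_diff)
  then obtain j k where "a + b - 1 = 3 * j" "m - n - (1 - a) = 3 * k"
    by (auto elim!: dvdE)
  then have b: "b = 3 * j + 1 - a" and m: "m = n + 1 - a + 3 * k" by linarith+
  let ?B = "0 \<le> k \<and> k < j \<and> 0 \<le> n + k \<and> n + k < j \<and> a - 1 - j \<le> n + 2 * k \<and> n + 2 * k \<le> a - 2"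
  note defs = b m benzel_cells_def mem_Collect_eq prod.case
  have "(m, n) \<in> benzel_cells a b \<longleftrightarrow> ?B"
    unfolding defs by (intro arg_cong2[where f = "(\<and>)"]; presburger)
  moreover have "(m + 1, n) \<in> benzel_cells a b \<longleftrightarrow> ?B"
    unfolding defs by (intro arg_cong2[where f = "(\<and>)"]; presburger)
  moreover have "(m + 1, n - 1) \<in> benzel_cells a b \<longleftrightarrow> ?B"
    unfolding defs by (intro arg_cong2[where f = "(\<and>)"]; presburger)
  ultimately show "(m + 1, n) \<in> benzel_cells a b \<longleftrightarrow> (m, n) \<in> benzel_cells a b"
    "(m + 1, n - 1) \<in> benzel_cells a b \<longleftrightarrow> (m, n) \<in> benzel_cells a b" by blast+
qed

lemma aligned_stones_tiling:
  assumes ab: "[a + b = 1] (mod 3)"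
  shows "tromino_tiling (benzel_cells a b) (aligned_stones (1 - a) (benzel_cells a b))"
  unfolding tromino_tiling_def
proof (intro conjI ballI)
  fix A assume "A \<in> aligned_stones (1 - a) (benzel_cells a b)"
  then show "A \<in> trominoes" "A \<subseteq> benzel_cells a b"
    using aligned_stone_in_benzel[OF ab]
    by (auto simp: aligned_stones_def trominoes_def stone_def)
next
  fix p assume p: "p \<in> benzel_cells a b"
  obtain m n where mn: "p = (m, n)" by (cases p)
  have stone: "p \<in> stone (i, j) \<longleftrightarrow>
      (i, j) = (m, n) \<or> (i, j) = (m - 1, n) \<or> (i, j) = (m - 1, n + 1)" for i j
    by (auto simp: mn stone_def)
  \<comment> \<open>Exactly one of these three positions has a content in the right residue class.\<close>
  have "\<exists>m' n'. \<forall>i j. [i - j = 1 - a] (mod 3) \<and> p \<in> stone (i, j) \<longleftrightarrow> i = m' \<and> j = n'"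
  proof (cases rule: residue_cases[of "m - n" "1 - a"])
    case (1 k)
    then have "3 dvd m - n - (1 - a)" "\<not> 3 dvd m - 1 - n - (1 - a)"
      "\<not> 3 dvd m - 1 - (n + 1) - (1 - a)" by presburger+
    then show ?thesis
      unfolding stone cong_iff_dvd_diff by (intro exI[of _ m] exI[of _ n]) auto
  next
    case (2 k)
    then have "\<not> 3 dvd m - n - (1 - a)" "3 dvd m - 1 - n - (1 - a)"
      "\<not> 3 dvd m - 1 - (n + 1) - (1 - a)" by presburger+
    then show ?thesis
      unfolding stone cong_iff_dvd_diff by (intro exI[of _ "m - 1"] exI[of _ n]) auto
  next
    case (3 k)
    then have "\<not> 3 dvd m - n - (1 - a)" "\<not> 3 dvd m - 1 - n - (1 - a)"
      "3 dvd m - 1 - (n + 1) - (1 - a)" by presburger+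
    then show ?thesis
      unfolding stone cong_iff_dvd_diff by (intro exI[of _ "m - 1"] exI[of _ "n + 1"]) auto
  qed
  then obtain m' n' where *:
    "[i - j = 1 - a] (mod 3) \<and> p \<in> stone (i, j) \<longleftrightarrow> i = m' \<and> j = n'" for i j by blast
  then have c: "[m' - n' = 1 - a] (mod 3)" "p \<in> stone (m', n')" by auto
  with p have "(m', n') \<in> benzel_cells a b"
    using aligned_stone_in_benzel[OF ab c(1)] by (auto simp: stone_def)
  show "\<exists>!A. A \<in> aligned_stones (1 - a) (benzel_cells a b) \<and> p \<in> A"
  proof (rule ex1I)
    show "stone (m', n') \<in> aligned_stones (1 - a) (benzel_cells a b) \<and> p \<in> stone (m', n')"
      using c \<open>(m', n') \<in> _\<close> by (auto simp: aligned_stones_def)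
    fix A assume "A \<in> aligned_stones (1 - a) (benzel_cells a b) \<and> p \<in> A"
    then obtain i j where "A = stone (i, j)" "[i - j = 1 - a] (mod 3)" "p \<in> stone (i, j)"
      unfolding aligned_stones_def by blast
    with *[of i j] show "A = stone (m', n')" by blast
  qed
qed

text \<open>When the hexagon is a triangle, the bounds involving \<open>b\<close> follow from the others. Raising
  \<open>b\<close> by one therefore changes no cell, but makes \<open>a + b\<close> congruent to \<open>1\<close>.\<close>

lemma benzel_cells_degenerate: "benzel_cells a (2 * a) = benzel_cells a (2 * a + 1)"
  by (auto simp: benzel_cells_def)

lemma unique_tromino_tiling:
  assumes "[a + b = 1] (mod 3)"
  shows "\<exists>!X. tromino_tiling (benzel_cells a b) X"
proof
  let ?Y = "aligned_stones (1 - a) (benzel_cells a b)"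
  show Y: "tromino_tiling (benzel_cells a b) ?Y" by (rule aligned_stones_tiling[OF assms])
  fix X assume X: "tromino_tiling (benzel_cells a b) X"
  show "X = ?Y"
  proof (rule tiling_unique_if_weight_vanishes_on_it[OF finite_benzel_cells Y _ _ X])
    fix A assume A: "A \<in> trominoes" "A \<subseteq> benzel_cells a b"
    show "0 \<le> sum (aligned_weight (1 - a)) A"
      using A(1) by (cases rule: tromino_cases)
        (auto simp: aligned_weight_stone intro: less_imp_le aligned_weight_bone)
    have "A \<in> ?Y" if "A = stone (m, n)" "[m - n = 1 - a] (mod 3)" for m n
      using A(2) that unfolding aligned_stones_def by (auto simp: stone_def)
    moreover have "sum (aligned_weight (1 - a)) A = 0" if "A \<in> ?Y"
      using that by (auto simp: aligned_stones_def aligned_weight_stone)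
    moreover have "\<exists>m n. A = stone (m, n) \<and> [m - n = 1 - a] (mod 3)"
      if "sum (aligned_weight (1 - a)) A = 0"
      using A(1)
    proof (cases rule: tromino_cases)
      case (stone m n)
      with that show ?thesis by (auto simp: aligned_weight_stone)
    next
      case (rising m n)
      with that aligned_weight_bone(1)[of "1 - a" m n] show ?thesis by simp
    next
      case (falling m n)
      with that aligned_weight_bone(2)[of "1 - a" m n] show ?thesis by simp
    qed
    ultimately show "sum (aligned_weight (1 - a)) A = 0 \<longleftrightarrow> A \<in> ?Y" by blast
  qed
qed

section \<open>An obstruction at a corner of the benzel\<close>

text \<open>The weight depends on the content only through its distance \<open>e\<close> from \<open>p\<close>, so it is
  invariant under the reflection about the diagonal of content \<open>p\<close>, which exchanges rising and
  falling bones. Read away from that diagonal, the heights along a tile still go up twice, down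
  twice, or up and then down. On the distances \<open>3 * k + 1\<close> and \<open>3 * k + 2\<close> the weights \<open>s + q + k\<close>
  and \<open>1 - (s + q + k)\<close> cancel when the height rises by one from the first to the second, and sum
  to \<open>2\<close> when it falls. Hence they vanish in total on a region whose diagonals at these distances
  differ by such a rise. The summand \<open>k\<close> keeps the tiles from distance \<open>3 * k + 2\<close> to \<open>3 * k + 4\<close>
  nonnegative, and \<open>q\<close> is chosen large enough for the weights at distance one to be nonnegative on
  the region.\<close>

definition mirror_weight :: "int \<Rightarrow> int \<Rightarrow> int \<times> int \<Rightarrow> int" where
  "mirror_weight p q = (\<lambda>(m, n). let e = \<bar>m - n - p\<bar>; k = e div 3 in
     if e mod 3 = 0 then 0
     else if e mod 3 = 1 then m + n + q + k
     else 1 - (m + n + q + k))"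

lemma mirror_weight_right:
  assumes "0 \<le> k"
  shows "m - n = p + 3 * k \<Longrightarrow> mirror_weight p q (m, n) = 0"
    and "m - n = p + 3 * k + 1 \<Longrightarrow> mirror_weight p q (m, n) = m + n + q + k"
    and "m - n = p + 3 * k + 2 \<Longrightarrow> mirror_weight p q (m, n) = 1 - (m + n + q + k)"
proof -
  have *: "\<bar>m - n - p\<bar> = 3 * k + r" if "m - n = p + 3 * k + r" "0 \<le> r" for r
    using that assms by simp
  show "m - n = p + 3 * k \<Longrightarrow> mirror_weight p q (m, n) = 0"
    using *[of 0] by (simp add: mirror_weight_def Let_def)
  show "m - n = p + 3 * k + 1 \<Longrightarrow> mirror_weight p q (m, n) = m + n + q + k"
    using *[of 1] by (simp add: mirror_weight_def Let_def)
  show "m - n = p + 3 * k + 2 \<Longrightarrow> mirror_weight p q (m, n) = 1 - (m + n + q + k)"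
    using *[of 2] by (simp add: mirror_weight_def Let_def)
qed

lemma mirror_weight_left:
  assumes "0 \<le> k"
  shows "m - n = p - 3 * k \<Longrightarrow> mirror_weight p q (m, n) = 0"
    and "m - n = p - 3 * k - 1 \<Longrightarrow> mirror_weight p q (m, n) = m + n + q + k"
    and "m - n = p - 3 * k - 2 \<Longrightarrow> mirror_weight p q (m, n) = 1 - (m + n + q + k)"
proof -
  have *: "\<bar>m - n - p\<bar> = 3 * k + r" if "m - n = p - 3 * k - r" "0 \<le> r" for r
    using that assms by simp
  show "m - n = p - 3 * k \<Longrightarrow> mirror_weight p q (m, n) = 0"
    using *[of 0] by (simp add: mirror_weight_def Let_def)
  show "m - n = p - 3 * k - 1 \<Longrightarrow> mirror_weight p q (m, n) = m + n + q + k"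
    using *[of 1] by (simp add: mirror_weight_def Let_def)
  show "m - n = p - 3 * k - 2 \<Longrightarrow> mirror_weight p q (m, n) = 1 - (m + n + q + k)"
    using *[of 2] by (simp add: mirror_weight_def Let_def)
qed

text \<open>The content of the first cell of a tile, sorted by the position of the whole tile: right of
  the diagonal \<open>p\<close>, centered on it, or left of it. On the left the last cell, of content
  \<open>d + 2\<close>, is the nearest to the diagonal, and the names give its distance modulo three.\<close>

lemma mirror_cases:
  fixes d p :: int
  obtains (right0) k where "0 \<le> k" "d = p + 3 * k"
    | (right1) k where "0 \<le> k" "d = p + 3 * k + 1"
    | (right2) k where "0 \<le> k" "d = p + 3 * k + 2"
    | (middle) "d = p - 1"
    | (left2) k where "0 \<le> k" "d = p - 3 * k - 2"
    | (left0) k where "0 \<le> k" "d = p - 3 * k - 3"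
    | (left1) k where "0 \<le> k" "d = p - 3 * k - 4"
proof -
  have "(\<exists>k\<ge>0. d = p + 3 * k \<or> d = p + 3 * k + 1 \<or> d = p + 3 * k + 2) \<or> d = p - 1 \<or>
    (\<exists>k\<ge>0. d = p - 3 * k - 2 \<or> d = p - 3 * k - 3 \<or> d = p - 3 * k - 4)"
    by presburger
  then show thesis using that by blast
qed

text \<open>A tile contains cells at distances \<open>3 * k + 1\<close> and \<open>3 * k + 2\<close> next to each other, or at
  \<open>3 * k + 2\<close> and \<open>3 * k + 4\<close>, whose weights nearly cancel, or it is centered on the diagonal and
  contains two cells at distance one. Only in the last case can the weight be negative, far below
  the region, and the lower bound on these cells excludes that.\<close>

lemma mirror_weight_tromino_nonneg:
  assumes "A \<in> trominoes"
    and low: "\<And>m n. (m, n) \<in> A \<Longrightarrow> \<bar>m - n - p\<bar> = 1 \<Longrightarrow> 0 \<le> m + n + q"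
  shows "0 \<le> sum (mirror_weight p q) A"
proof -
  obtain m n where A: "A = stone (m, n) \<or> A = rising (m, n) \<or> A = falling (m, n)"
    using assms(1) by (auto simp: trominoes_def)
  note sums = sum_stone sum_rising sum_falling
  show ?thesis
  proof (cases rule: mirror_cases[of "m - n" p])
    case (right0 k)
    with A show ?thesis
      by (elim disjE) (simp_all add: sums mirror_weight_right[of k])
  next
    case (right1 k)
    with A show ?thesis
      by (elim disjE) (simp_all add: sums mirror_weight_right[of k] mirror_weight_right[of "k + 1"])
  next
    case (right2 k)
    with A show ?thesis
      by (elim disjE) (simp_all add: sums mirror_weight_right[of k] mirror_weight_right[of "k + 1"])
  next
    case middle
    from A show ?thesis
    proof (elim disjE)
      assume A: "A = stone (m, n)"
      show ?thesis
        using middle low[of m n] low[of "m + 1" "n - 1"] unfolding A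
        by (simp add: sums mirror_weight_left[of 0] mirror_weight_right[of 0] stone_def)
    next
      assume A: "A = rising (m, n)"
      show ?thesis
        using middle low[of m n] low[of m "n - 2"] unfolding A
        by (simp add: sums mirror_weight_left[of 0] mirror_weight_right[of 0] rising_def)
    next
      assume A: "A = falling (m, n)"
      show ?thesis
        using middle low[of m n] low[of "m + 2" n] unfolding A
        by (simp add: sums mirror_weight_left[of 0] mirror_weight_right[of 0] falling_def)
    qed
  next
    case (left2 k)
    with A show ?thesis
      by (elim disjE) (simp_all add: sums mirror_weight_left[of k])
  next
    case (left0 k)
    with A show ?thesis
      by (elim disjE) (simp_all add: sums mirror_weight_left[of k] mirror_weight_left[of "k + 1"])
  next
    case (left1 k)
    with A show ?thesis
      by (elim disjE) (simp_all add: sums mirror_weight_left[of k] mirror_weight_left[of "k + 1"])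
  qed
qed

text \<open>Matches the cells at distances \<open>3 * k + 1\<close> and \<open>3 * k + 2\<close> from the diagonal of content \<open>p\<close>
  in pairs that differ by a step away from the diagonal and up; cells at other distances are
  fixed.\<close>

definition mirror_partner :: "int \<Rightarrow> int \<times> int \<Rightarrow> int \<times> int" where
  "mirror_partner p = (\<lambda>(m, n).
     let r = \<bar>m - n - p\<bar> mod 3; j = (if r = 0 then 0 else if r = 1 then 1 else - 1) in
     if p \<le> m - n then (m + j, n) else (m, n + j))"

text \<open>If \<open>a + b\<close> is divisible by three, then \<open>a = 2 * u + v\<close> and \<open>b = u + 2 * v\<close> for integers
  \<open>u\<close> and \<open>v\<close>, and \<open>u - v = a - b\<close> is the content of the longest diagonal of the benzel; its top
  cell is \<open>(u - 1, v - 1)\<close>, and the heights on this diagonal lie between \<open>- (u + v)\<close> and \<open>u + v - 2\<close>.\<close>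

context
  fixes u v :: int
  assumes uv: "0 < u" "0 < v"
begin

private abbreviation "R \<equiv> benzel_cells (2 * u + v) (u + 2 * v)"

private abbreviation "w \<equiv> mirror_weight (u - v) (u + v)"

lemma mirror_partner_props:
  assumes "x \<in> R"
  shows "mirror_partner (u - v) x \<in> R"
    and "mirror_partner (u - v) (mirror_partner (u - v) x) = x"
    and "w (mirror_partner (u - v) x) = - w x"
proof -
  obtain m n where x: "x = (m, n)" by (cases x)
  let ?\<phi> = "mirror_partner (u - v)"
  note defs = mirror_partner_def Let_def
  consider (on) k where "m - n - (u - v) = 3 * k"
    | (right1) k where "0 \<le> k" "m - n - (u - v) = 3 * k + 1"
    | (right2) k where "0 \<le> k" "m - n - (u - v) = 3 * k + 2"
    | (left1) k where "0 \<le> k" "m - n - (u - v) = - (3 * k + 1)"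
    | (left2) k where "0 \<le> k" "m - n - (u - v) = - (3 * k + 2)"
  proof -
    have "\<exists>k. d = 3 * k \<or> 0 \<le> k \<and> (d = 3 * k + 1 \<or> d = 3 * k + 2 \<or>
      d = - (3 * k + 1) \<or> d = - (3 * k + 2))" for d :: int by presburger
    then show thesis using that by blast
  qed
  then have "?\<phi> x \<in> R \<and> ?\<phi> (?\<phi> x) = x \<and> w (?\<phi> x) = - w x"
  proof cases
    case (on k)
    then have "\<bar>m - n - (u - v)\<bar> mod 3 = 0" by presburger
    then have "?\<phi> x = x" "w x = 0"
      unfolding defs mirror_weight_def x prod.case by (simp_all only: if_True) simp_all
    with assms show ?thesis by simp
  next
    case (right1 k)
    then have e: "\<bar>m - n - (u - v)\<bar> = 3 * k + 1" "\<bar>m + 1 - n - (u - v)\<bar> = 3 * k + 2"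
      and side: "u - v \<le> m - n" "u - v \<le> m + 1 - n" by simp_all
    have "?\<phi> (m, n) = (m + 1, n)" "?\<phi> (m + 1, n) = (m, n)"
      using side unfolding defs prod.case e by simp_all
    moreover have "w (m + 1, n) = - w (m, n)"
      using right1 by (simp add: mirror_weight_right[of k])
    moreover have "(m + 1, n) \<in> R"
    proof -
      have m: "m = n + (u - v) + 3 * k + 1" using right1 by simp
      have R: "1 - (2 * u + v) \<le> m - n" "m - n \<le> u + 2 * v - 1" "- (2 * u + v) \<le> m + 2 * n"
        "m + 2 * n \<le> u + 2 * v - 2" "- (u + 2 * v) \<le> 2 * m + n" "2 * m + n \<le> 2 * u + v - 2"
        using assms by (simp_all add: x benzel_cells_def)
      \<comment> \<open>The bounds that matter, rounded by means of the residues modulo three.\<close>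
      have "k \<le> v - 1" "0 \<le> n + u + k" "n + 2 * k - v \<le> - 2"
        using R m by linarith+
      then show ?thesis
        using R uv m \<open>0 \<le> k\<close>
        unfolding benzel_cells_def mem_Collect_eq prod.case distrib_left right_diff_distrib
        by (intro conjI; linarith)
    qed
    ultimately show ?thesis by (simp add: x)
  next
    case (right2 k)
    then have e: "\<bar>m - n - (u - v)\<bar> = 3 * k + 2" "\<bar>m - 1 - n - (u - v)\<bar> = 3 * k + 1"
      and side: "u - v \<le> m - n" "u - v \<le> m - 1 - n" by simp_all
    have "?\<phi> (m, n) = (m - 1, n)" "?\<phi> (m - 1, n) = (m, n)"
      using side unfolding defs prod.case e by simp_all
    moreover have "w (m - 1, n) = - w (m, n)"
      using right2 by (simp add: mirror_weight_right[of k])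
    moreover have "(m - 1, n) \<in> R"
    proof -
      have m: "m = n + (u - v) + 3 * k + 2" using right2 by simp
      have R: "1 - (2 * u + v) \<le> m - n" "m - n \<le> u + 2 * v - 1" "- (2 * u + v) \<le> m + 2 * n"
        "m + 2 * n \<le> u + 2 * v - 2" "- (u + 2 * v) \<le> 2 * m + n" "2 * m + n \<le> 2 * u + v - 2"
        using assms by (simp_all add: x benzel_cells_def)
      have "k \<le> v - 1" "0 \<le> n + u + k" "n + 2 * k - v \<le> - 2"
        using R m by linarith+
      then show ?thesis
        using R uv m \<open>0 \<le> k\<close>
        unfolding benzel_cells_def mem_Collect_eq prod.case distrib_left right_diff_distrib
        by (intro conjI; linarith)
    qed
    ultimately show ?thesis by (simp add: x)
  next
    case (left1 k)
    then have e: "\<bar>m - n - (u - v)\<bar> = 3 * k + 1" "\<bar>m - (n + 1) - (u - v)\<bar> = 3 * k + 2"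
      and side: "\<not> u - v \<le> m - n" "\<not> u - v \<le> m - (n + 1)" by simp_all
    have "?\<phi> (m, n) = (m, n + 1)" "?\<phi> (m, n + 1) = (m, n)"
      using side unfolding defs prod.case e by simp_all
    moreover have "w (m, n + 1) = - w (m, n)"
      using left1 by (simp add: mirror_weight_left[of k])
    moreover have "(m, n + 1) \<in> R"
    proof -
      have n: "n = m - (u - v) + 3 * k + 1" using left1 by simp
      have R: "1 - (2 * u + v) \<le> m - n" "m - n \<le> u + 2 * v - 1" "- (2 * u + v) \<le> m + 2 * n"
        "m + 2 * n \<le> u + 2 * v - 2" "- (u + 2 * v) \<le> 2 * m + n" "2 * m + n \<le> 2 * u + v - 2"
        using assms by (simp_all add: x benzel_cells_def)
      have "k \<le> u - 1" "0 \<le> m + v + k" "m + 2 * k - u \<le> - 2"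
        using R n by linarith+
      then show ?thesis
        using R uv n \<open>0 \<le> k\<close>
        unfolding benzel_cells_def mem_Collect_eq prod.case distrib_left right_diff_distrib
        by (intro conjI; linarith)
    qed
    ultimately show ?thesis by (simp add: x)
  next
    case (left2 k)
    then have e: "\<bar>m - n - (u - v)\<bar> = 3 * k + 2" "\<bar>m - (n - 1) - (u - v)\<bar> = 3 * k + 1"
      and side: "\<not> u - v \<le> m - n" "\<not> u - v \<le> m - (n - 1)" by simp_all
    have "?\<phi> (m, n) = (m, n - 1)" "?\<phi> (m, n - 1) = (m, n)"
      using side unfolding defs prod.case e by simp_all
    moreover have "w (m, n - 1) = - w (m, n)"
      using left2 by (simp add: mirror_weight_left[of k])
    moreover have "(m, n - 1) \<in> R"
    proof -
      have n: "n = m - (u - v) + 3 * k + 2" using left2 by simp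
      have R: "1 - (2 * u + v) \<le> m - n" "m - n \<le> u + 2 * v - 1" "- (2 * u + v) \<le> m + 2 * n"
        "m + 2 * n \<le> u + 2 * v - 2" "- (u + 2 * v) \<le> 2 * m + n" "2 * m + n \<le> 2 * u + v - 2"
        using assms by (simp_all add: x benzel_cells_def)
      have "k \<le> u - 1" "0 \<le> m + v + k" "m + 2 * k - u \<le> - 2"
        using R n by linarith+
      then show ?thesis
        using R uv n \<open>0 \<le> k\<close>
        unfolding benzel_cells_def mem_Collect_eq prod.case distrib_left right_diff_distrib
        by (intro conjI; linarith)
    qed
    ultimately show ?thesis by (simp add: x)
  qed
  then show "?\<phi> x \<in> R" "?\<phi> (?\<phi> x) = x" "w (?\<phi> x) = - w x" by auto
qed

lemma sum_mirror_weight: "sum w R = 0"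
proof -
  have "sum w R = (\<Sum>x\<in>R. - w x)"
    by (rule sum.reindex_bij_witness[of R "mirror_partner (u - v)" "mirror_partner (u - v)"])
       (simp_all add: mirror_partner_props)
  then show ?thesis by (simp add: sum_negf)
qed

lemma corner_in_benzel: "(u - 1, v - 1) \<in> R"
  using uv by (simp add: benzel_cells_def)

text \<open>A tile centered at the corner has two cells at distance one, both of positive weight. A
  tile that contains the corner and reaches distance two has weight zero only if its height
  rises twice away from the corner, and then its next cell lies above the benzel.\<close>

lemma mirror_weight_corner_pos:
  assumes "A \<in> trominoes" "A \<subseteq> R" "(u - 1, v - 1) \<in> A"
  shows "0 < sum w A"
  using assms(1)
proof (cases rule: tromino_cases)
  case (stone m n)
  then have "(m, n) = (u - 1, v - 1) \<or> (m, n) = (u - 2, v - 1) \<or> (m, n) = (u - 2, v)"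
    using assms(3) by (auto simp: stone_def)
  then show ?thesis
    using uv unfolding stone sum_stone
    by (elim disjE) (simp_all add: mirror_weight_left[of 0] mirror_weight_right[of 0])
next
  case (rising m n)
  then have "(m, n) = (u - 1, v - 1) \<or> (m, n) = (u - 1, v)"
    using assms(2,3) by (auto simp: rising_def benzel_cells_def)
  then show ?thesis
    using uv unfolding rising sum_rising
    by (elim disjE) (simp_all add: mirror_weight_left[of 0] mirror_weight_right[of 0])
next
  case (falling m n)
  then have "(m, n) = (u - 2, v - 1) \<or> (m, n) = (u - 3, v - 1)"
    using assms(2,3) by (auto simp: falling_def benzel_cells_def)
  then show ?thesis
    using uv unfolding falling sum_falling
    by (elim disjE) (simp_all add: mirror_weight_left[of 0] mirror_weight_right[of 0])
qed

lemma no_tromino_tiling: "\<not> tromino_tiling R X"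
proof
  assume X: "tromino_tiling R X"
  have low: "0 \<le> m + n + (u + v)" if "(m, n) \<in> R" "\<bar>m - n - (u - v)\<bar> = 1" for m n
    using that by (auto simp: benzel_cells_def abs_if split: if_splits)
  have nonneg: "0 \<le> sum w A" if "A \<in> X" for A
    using X that low by (intro mirror_weight_tromino_nonneg) (auto simp: tromino_tiling_def)
  obtain A where A: "A \<in> X" "(u - 1, v - 1) \<in> A"
    using X corner_in_benzel unfolding tromino_tiling_def by blast
  then have "0 < sum w A"
    using X by (intro mirror_weight_corner_pos) (auto simp: tromino_tiling_def)
  moreover have "finite X" using finite_tromino_tiling[OF finite_benzel_cells X] .
  ultimately have "0 < (\<Sum>A\<in>X. sum w A)"
    using A(1) nonneg sum_pos2[of X A "sum w"] by blast
  then show False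
    using sum_over_tiling[OF finite_benzel_cells X, of w] sum_mirror_weight by simp
qed

end

section \<open>Tilings of the benzel\<close>

theorem theorem1p3:
  fixes a b :: int
  assumes "2 \<le> a" and "a \<le> b" and "b \<le> 2 * a"
  shows "(b = 2 * a \<or> [a + b = 1] (mod 3) \<longrightarrow>
            (\<exists>!T. is_tiling {right_stone, rising_bone, falling_bone} (benzel a b) T)) \<and>
         (b < 2 * a \<and> [a + b = 0] (mod 3) \<longrightarrow>
            \<not> (\<exists>T. is_tiling {right_stone, rising_bone, falling_bone} (benzel a b) T))"
proof -
  have "benzel a b = region (benzel_cells a b)"
    using assms by (intro benzel_eq_region) simp_all
  then have tiling: "is_tiling prototiles (benzel a b) T \<longleftrightarrow>
      (\<exists>X. T = region ` X \<and> tromino_tiling (benzel_cells a b) X)" for T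
    by (simp only: is_tiling_region_iff)
  show ?thesis
  proof (intro conjI impI)
    assume *: "b = 2 * a \<or> [a + b = 1] (mod 3)"
    have "\<exists>!X. tromino_tiling (benzel_cells a b) X"
    proof (cases "b = 2 * a")
      case True
      have "[a + (2 * a + 1) = 1] (mod 3)" by (simp add: cong_iff_dvd_diff)
      then show ?thesis
        unfolding True benzel_cells_degenerate by (rule unique_tromino_tiling)
    next
      case False
      with * show ?thesis by (intro unique_tromino_tiling) simp
    qed
    then show "\<exists>!T. is_tiling prototiles (benzel a b) T"
      unfolding tiling by blast
  next
    assume *: "b < 2 * a \<and> [a + b = 0] (mod 3)"
    then obtain q where q: "a + b = 3 * q"
      by (auto simp: cong_0_iff elim!: dvdE)
    have ab: "2 * (a - q) + (b - q) = a" "(a - q) + 2 * (b - q) = b"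
      using q by (simp_all add: algebra_simps)
    have pos: "0 < a - q" "0 < b - q" using * q assms by linarith+
    have "\<not> tromino_tiling (benzel_cells a b) X" for X
      using no_tromino_tiling[OF pos, of X] by (simp only: ab not_False_eq_True)
    then show "\<not> (\<exists>T. is_tiling prototiles (benzel a b) T)"
      unfolding tiling by blast
  qed
qed

end
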